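(* Let $G=G(V,E)$ be a finite simple graph and let $n\ge |V|$ be an integer. If $\mathrm{bal}(n,G)$ exists, then $\mathrm{bal}(n,G)=\mathrm{lbal}(n,G)<\frac{1}{2}\binom{n}{2}$.
   Context: A 2-coloring of the edges of $K_n$ is a partition $E(K_n)=R\sqcup B$ (red edges and blue edges). A 2-list coloring of the edges of $K_n$ is a function $L:E(K_n)\to\{\{r\},\{b\},\{r,b\}\}$; it induces color classes $R=\{e: r\in L(e)\}$ and $B=\{e: b\in L(e)\}$, so $R\cup B=E(K_n)$ but $R$ and $B$ may intersect. Given a 2-coloring or a 2-list coloring with color classes $R,B$, a balanced copy of a graph $G=G(V,E)$ is a (not necessarily induced) copy of $G$ in $K_n$ whose edge set has a partition $E_1\sqcup E_2$ with $E_1\subseteq R$, $E_2\subseteq B$ and $\bigl||E_1|-|E_2|\bigr|\le 1$. Balancing number: $\mathrm{bal}(n,G)$ is the smallest integer $k$ such that every 2-coloring $R\sqcup B$ of the edges of $K_n$ with $|R|,|B|>k$ contains a balanced copy of $G$, where the condition $|R|,|B|>k$ is required to be satisfiable by some 2-coloring, i.e. $2(k+1)\le\binom{n}{2}$; $\mathrm{bal}(n,G)$ exists if there is such a $k$. List balancing number: for $n\ge |V|$, $\mathrm{lbal}(n,G)$ is the smallest integer $k$ such that every 2-list coloring of the edges of $K_n$ with color classes satisfying $|R|,|B|>k$ contains a balanced copy of $G$. *)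

theory Defs
  imports Complex_Main "HOL-Library.Ramsey"
begin

(* [A]\<^bsup>2\<^esup> is the set of two-element subsets of A, as in HOL-Library.Ramsey. *)

definition simple_graph :: "'a set \<Rightarrow> 'a set set \<Rightarrow> bool" where
  "simple_graph V E \<longleftrightarrow> E \<subseteq> [V]\<^bsup>2\<^esup>"

definition K_edges :: "nat \<Rightarrow> nat set set" where
  "K_edges n = [{..<n}]\<^bsup>2\<^esup>"

definition two_coloring :: "nat \<Rightarrow> nat set set \<Rightarrow> nat set set \<Rightarrow> bool" where
  "two_coloring n R B \<longleftrightarrow> R \<union> B = K_edges n \<and> R \<inter> B = {}"

datatype color = Red | Blue

(* L is only constrained on the edges of the complete graph; its other values never matter. *)
definition two_list_coloring :: "nat \<Rightarrow> (nat set \<Rightarrow> color set) \<Rightarrow> bool" where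
  "two_list_coloring n L \<longleftrightarrow> (\<forall>e\<in>K_edges n. L e \<in> {{Red}, {Blue}, {Red, Blue}})"

definition color_class :: "nat \<Rightarrow> (nat set \<Rightarrow> color set) \<Rightarrow> color \<Rightarrow> nat set set" where
  "color_class n L c = {e \<in> K_edges n. c \<in> L e}"

(* The copy of (V, E) given by the injection f has the edge set (`) f ` E. *)
definition has_balanced_copy ::
  "nat \<Rightarrow> 'a set \<Rightarrow> 'a set set \<Rightarrow> nat set set \<Rightarrow> nat set set \<Rightarrow> bool" where
  "has_balanced_copy n V E R B \<longleftrightarrow>
    (\<exists>f E1 E2. inj_on f V \<and> f ` V \<subseteq> {..<n} \<and>
       (`) f ` E = E1 \<union> E2 \<and> E1 \<inter> E2 = {} \<and> E1 \<subseteq> R \<and> E2 \<subseteq> B \<and>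
       \<bar>int (card E1) - int (card E2)\<bar> \<le> 1)"

(* Thresholds are natural numbers: for a negative k the condition on the sizes of the colour
   classes is void, so if one negative integer were a threshold then all of them would be and
   there would be no smallest one.  The first conjunct says that some 2-coloring meets the size condition; see
   satisfiable_iff. *)
definition bal_threshold :: "nat \<Rightarrow> 'a set \<Rightarrow> 'a set set \<Rightarrow> nat \<Rightarrow> bool" where
  "bal_threshold n V E k \<longleftrightarrow>
    (\<exists>R B. two_coloring n R B \<and> card R > k \<and> card B > k) \<and>
    (\<forall>R B. two_coloring n R B \<and> card R > k \<and> card B > k \<longrightarrow> has_balanced_copy n V E R B)"

definition bal_exists :: "nat \<Rightarrow> 'a set \<Rightarrow> 'a set set \<Rightarrow> bool" where
  "bal_exists n V E \<longleftrightarrow> (\<exists>k. bal_threshold n V E k)"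

(* Meaningful only under bal_exists. *)
definition bal :: "nat \<Rightarrow> 'a set \<Rightarrow> 'a set set \<Rightarrow> nat" where
  "bal n V E = (LEAST k. bal_threshold n V E k)"

definition lbal_threshold :: "nat \<Rightarrow> 'a set \<Rightarrow> 'a set set \<Rightarrow> nat \<Rightarrow> bool" where
  "lbal_threshold n V E k \<longleftrightarrow>
    (\<forall>L. two_list_coloring n L \<and>
         card (color_class n L Red) > k \<and> card (color_class n L Blue) > k \<longrightarrow>
       has_balanced_copy n V E (color_class n L Red) (color_class n L Blue))"

(* Always meaningful, by lbal_threshold_exists. *)
definition lbal :: "nat \<Rightarrow> 'a set \<Rightarrow> 'a set set \<Rightarrow> nat" where
  "lbal n V E = (LEAST k. lbal_threshold n V E k)"

lemma finite_K_edges: "finite (K_edges n)"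
  by (simp add: K_edges_def finite_imp_finite_nsets)

lemma card_K_edges: "card (K_edges n) = n choose 2"
  by (simp add: K_edges_def)

lemma lbal_threshold_exists: "\<exists>k. lbal_threshold n V E k"
proof -
  have "card (color_class n L Red) \<le> card (K_edges n)" for L
    by (rule card_mono) (auto simp: color_class_def finite_K_edges)
  then have "lbal_threshold n V E (card (K_edges n))"
    by (auto simp: lbal_threshold_def not_less dest: leD)
  then show ?thesis ..
qed

lemma satisfiable_iff:
  "(\<exists>R B. two_coloring n R B \<and> card R > k \<and> card B > k) \<longleftrightarrow> 2 * (k + 1) \<le> n choose 2"
proof
  assume "\<exists>R B. two_coloring n R B \<and> card R > k \<and> card B > k"
  then obtain R B where RB: "R \<union> B = K_edges n" "R \<inter> B = {}" and k: "card R > k" "card B > k"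
    by (auto simp: two_coloring_def)
  have "finite R" "finite B"
    using RB(1) finite_K_edges[of n] by (metis finite_Un)+
  then have "card R + card B = n choose 2"
    using RB card_Un_disjoint card_K_edges by metis
  moreover have "k + 1 \<le> card R" "k + 1 \<le> card B"
    using k by simp_all
  ultimately show "2 * (k + 1) \<le> n choose 2"
    by (metis add_mono mult_2)
next
  assume *: "2 * (k + 1) \<le> n choose 2"
  then have "k + 1 \<le> card (K_edges n)"
    by (simp add: card_K_edges)
  then obtain R where R: "R \<subseteq> K_edges n" "card R = k + 1" "finite R"
    by (rule obtain_subset_with_card_n)
  have "card (K_edges n - R) = (n choose 2) - (k + 1)"
    using R by (simp add: card_Diff_subset card_K_edges)
  then have "two_coloring n R (K_edges n - R) \<and> card R > k \<and> card (K_edges n - R) > k"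
    using R * by (auto simp: two_coloring_def)
  then show "\<exists>R B. two_coloring n R B \<and> card R > k \<and> card B > k"
    by blast
qed

end

theory Submission
  imports Defs
begin

text \<open>
  A 2-coloring is a 2-list coloring with disjoint classes. Conversely, if
  \<open>2 * (k + 1) \<le> n choose 2\<close>, the edges with list \<open>{Red, Blue}\<close> can be distributed so that both
  classes keep more than \<open>k\<close> edges. So for such \<open>k\<close> the two threshold properties agree, and if one
  such \<open>k\<close> is a threshold, then the least list threshold is below it and hence of this kind too.
\<close>

text \<open>The same embedding and the same split \<open>E1\<close>, \<open>E2\<close> serve as
  witnesses. This carries a balanced copy found in a 2-coloring back to the larger classes of a list
  coloring.\<close>

lemma has_balanced_copy_mono:
  assumes "has_balanced_copy n V E R B" "R \<subseteq> R'" "B \<subseteq> B'"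
  shows "has_balanced_copy n V E R' B'"
proof -
  obtain f E1 E2 where "inj_on f V \<and> f ` V \<subseteq> {..<n} \<and>
      (`) f ` E = E1 \<union> E2 \<and> E1 \<inter> E2 = {} \<and> E1 \<subseteq> R \<and> E2 \<subseteq> B \<and>
      \<bar>int (card E1) - int (card E2)\<bar> \<le> 1"
    using assms(1) unfolding has_balanced_copy_def by (elim exE)
  then show ?thesis
    unfolding has_balanced_copy_def
    by (intro exI[of _ f] exI[of _ E1] exI[of _ E2])
      (simp add: subset_trans[OF _ assms(2)] subset_trans[OF _ assms(3)])
qed

lemma two_coloring_within_cover:
  assumes cover: "R \<union> B = K_edges n" and k: "card R > k" "card B > k"
    and sat: "2 * (k + 1) \<le> n choose 2"
  obtains R' B' where "two_coloring n R' B'" "R' \<subseteq> R" "B' \<subseteq> B" "card R' > k" "card B' > k"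
proof -
  \<comment> \<open>Edges of \<open>R - B\<close> can only be red, and more than \<open>k\<close>
    red edges are wanted. \<open>?m\<close> is the least size of \<open>R'\<close> meeting both
    demands, which leaves as many edges as possible to blue.\<close>
  let ?m = "max (k + 1) (card (R - B))"
  have fin: "finite R" "finite B"
    using cover finite_K_edges[of n] by (metis finite_Un)+
  have "card (R - B) \<le> card R"
    using fin by (intro card_mono) auto
  then obtain R' where R': "R - B \<subseteq> R'" "R' \<subseteq> R" "card R' = ?m"
    using exists_subset_between[of "R - B" ?m R] k fin by auto
  have "(R - B) \<union> B = K_edges n"
    using cover by blast
  then have "card (R - B) + card B = n choose 2"
    using card_Un_disjoint[of "R - B" B] fin by (simp add: card_K_edges Int_commute)
  moreover have "card (K_edges n - R') = (n choose 2) - ?m"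
    using R' cover finite_subset[OF R'(2) fin(1)]
    by (subst card_Diff_subset) (auto simp: card_K_edges)
  \<comment> \<open>If the maximum is \<open>card (R - B)\<close>, the complement has exactly
    \<open>card B\<close> edges; if it is \<open>k + 1\<close>, the bound \<open>sat\<close> leaves
    at least \<open>k + 1\<close> edges.\<close>
  ultimately have "card (K_edges n - R') > k"
    using k sat by (auto simp: less_diff_conv max_def)
  moreover have "two_coloring n R' (K_edges n - R')" "K_edges n - R' \<subseteq> B"
    using R' cover by (auto simp: two_coloring_def)
  ultimately show ?thesis
    using that[of R' "K_edges n - R'"] R' by simp
qed

lemma color_classes_cover:
  assumes "two_list_coloring n L"
  shows "color_class n L Red \<union> color_class n L Blue = K_edges n"
  using assms by (fastforce simp: two_list_coloring_def color_class_def)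

lemma two_coloring_as_list_coloring:
  assumes "two_coloring n R B"
  obtains L where "two_list_coloring n L" "color_class n L Red = R" "color_class n L Blue = B"
proof
  let ?L = "\<lambda>e. if e \<in> R then {Red} else {Blue}"
  show "two_list_coloring n ?L"
    by (simp add: two_list_coloring_def)
  show "color_class n ?L Red = R" "color_class n ?L Blue = B"
    using assms by (auto simp: color_class_def two_coloring_def)
qed

text \<open>The size bound is the satisfiability condition hidden in \<open>bal_threshold\<close>.
  It has to stand beside \<open>lbal_threshold\<close>, which holds vacuously for large
  \<open>k\<close>.\<close>

lemma bal_threshold_iff_lbal_threshold:
  "bal_threshold n V E k \<longleftrightarrow> 2 * (k + 1) \<le> n choose 2 \<and> lbal_threshold n V E k"
proof (intro iffI conjI)
  assume bal: "bal_threshold n V E k"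
  then show sat: "2 * (k + 1) \<le> n choose 2"
    unfolding bal_threshold_def satisfiable_iff by blast
  show "lbal_threshold n V E k"
    unfolding lbal_threshold_def
  proof (intro allI impI)
    fix L
    assume L: "two_list_coloring n L \<and>
      card (color_class n L Red) > k \<and> card (color_class n L Blue) > k"
    obtain R B where "two_coloring n R B" "R \<subseteq> color_class n L Red"
      "B \<subseteq> color_class n L Blue" "card R > k" "card B > k"
      by (rule two_coloring_within_cover[OF color_classes_cover _ _ sat]) (use L in auto)
    moreover from this have "has_balanced_copy n V E R B"
      using bal by (simp add: bal_threshold_def)
    ultimately show "has_balanced_copy n V E (color_class n L Red) (color_class n L Blue)"
      using has_balanced_copy_mono by blast
  qed
next
  assume *: "2 * (k + 1) \<le> n choose 2 \<and> lbal_threshold n V E k"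
  have "has_balanced_copy n V E R B" if RB: "two_coloring n R B" "card R > k" "card B > k" for R B
  proof -
    obtain L where "two_list_coloring n L" "color_class n L Red = R" "color_class n L Blue = B"
      using RB(1) by (rule two_coloring_as_list_coloring)
    then show ?thesis
      using * RB by (auto simp: lbal_threshold_def)
  qed
  then show "bal_threshold n V E k"
    using * by (simp add: bal_threshold_def satisfiable_iff)
qed

theorem proposition4:
  fixes V :: "'a set" and E :: "'a set set" and n :: nat
  assumes "finite V" and "simple_graph V E"
    and "n \<ge> card V"
    and "bal_exists n V E"
  shows "bal n V E = lbal n V E \<and> real (lbal n V E) < 1 / 2 * real (n choose 2)"
proof -
  have "bal_threshold n V E (bal n V E)"
    using assms(4) unfolding bal_exists_def bal_def by (rule LeastI_ex)
  then have sat: "2 * (bal n V E + 1) \<le> n choose 2" and "lbal_threshold n V E (bal n V E)"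
    by (simp_all only: bal_threshold_iff_lbal_threshold)
  then have le: "lbal n V E \<le> bal n V E"
    unfolding lbal_def by (intro Least_le)
  have "lbal_threshold n V E (lbal n V E)"
    unfolding lbal_def using lbal_threshold_exists by (rule LeastI_ex)
  \<comment> \<open>The size bound passes from \<open>bal\<close> down to the smaller
    \<open>lbal\<close>.\<close>
  then have "bal_threshold n V E (lbal n V E)"
    using le sat by (simp add: bal_threshold_iff_lbal_threshold)
  then have "bal n V E \<le> lbal n V E"
    unfolding bal_def by (rule Least_le)
  with le have eq: "bal n V E = lbal n V E"
    by simp
  \<comment> \<open>The summand 1 in the size bound makes the final inequality strict.\<close>
  have "2 * real (bal n V E + 1) \<le> real (n choose 2)"
    using of_nat_mono[OF sat, where 'a = real] by simp
  with eq show ?thesis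
    by simp
qed

end
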